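(* Let $b\ge3$ be an integer, let $T_b:[0,1)\to[0,1)$, $x\mapsto bx\pmod 1$, and let $\phi:\mathbb{N}\to(0,\infty)$ be a function. Let $$E(\phi)=\{x\in[0,1): |T_b^n(x)-x|\ge\phi(n)\text{ for all but finitely many }n\}.$$ (i) If $\lim_{n\to\infty}\phi(n)=0$, then $\dim_H E(\phi)=1$. (ii) If $\dim_H E(\phi)=1$, then $\liminf_{n\to\infty}\phi(n)=0$.
   Context: $\mathbb{N}=\{1,2,\ldots\}$; $\dim_H$ denotes Hausdorff dimension. *)

theory Defs
  imports "HOL-Analysis.Analysis"
begin

text \<open>Hausdorff measure and Hausdorff dimension in a metric space, by countable covers with sets
  of small diameter.\<close>

(* 0 powr 0 = 0 in HOL, whereas the convention here is diam(U)^0 = 1 for every nonempty U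
   (so that the zero-dimensional Hausdorff measure is the counting measure). *)
definition diam_pow :: "real \<Rightarrow> 'a::metric_space set \<Rightarrow> ennreal" where
  "diam_pow s U = (if U = {} then 0 else if s = 0 then 1 else ennreal (diameter U powr s))"

(* Boundedness is required explicitly because diameter has no meaningful value on an unbounded
   set. A cover by finitely many sets is padded with empty ones. *)
definition hausdorff_covers :: "real \<Rightarrow> 'a::metric_space set \<Rightarrow> (nat \<Rightarrow> 'a set) set" where
  "hausdorff_covers \<delta> A =
     {U. A \<subseteq> (\<Union>i. U i) \<and> (\<forall>i. bounded (U i) \<and> diameter (U i) \<le> \<delta>)}"

definition hausdorff_premeasure :: "real \<Rightarrow> real \<Rightarrow> 'a::metric_space set \<Rightarrow> ennreal" where
  "hausdorff_premeasure s \<delta> A = (INF U\<in>hausdorff_covers \<delta> A. \<Sum>i. diam_pow s (U i))"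

definition hausdorff_measure :: "real \<Rightarrow> 'a::metric_space set \<Rightarrow> ennreal" where
  "hausdorff_measure s A = (SUP \<delta>\<in>{0<..}. hausdorff_premeasure s \<delta> A)"

definition hausdorff_dim :: "'a::metric_space set \<Rightarrow> ennreal" where
  "hausdorff_dim A = Inf {ennreal s | s. 0 \<le> s \<and> hausdorff_measure s A = 0}"

definition T_map :: "nat \<Rightarrow> real \<Rightarrow> real" where
  "T_map b x = frac (real b * x)"

definition E_set :: "nat \<Rightarrow> (nat \<Rightarrow> real) \<Rightarrow> real set" where
  "E_set b \<phi> = {x \<in> {0..<1}. \<forall>\<^sub>F n in sequentially. \<bar>(T_map b ^^ n) x - x\<bar> \<ge> \<phi> n}"

end

(*
  (i) Put B = b^k. Points whose base-B digits start with three zeros and then lie in {1..B-2} stay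
  at distance at least B^-2 - B^-3 from their orbits, so they lie in E(phi) once phi < B^-2 - B^-3.
  Subtracting 1 from the digits and reading them in base B - 2 maps this Cantor set onto the unit
  interval by a Hoelder map of exponent log_B (B-2), which bounds the dimension from below and
  tends to 1 as k grows.

  (ii) If phi >= eps eventually and B = b^k >= 1/eps, then the orbit of x under T_b^k eventually
  avoids the base-B cylinder containing x. Hence E(phi) is a countable union of sets of points that
  miss one base-B digit from some position on, each of dimension at most log_B (B-1).
*)
theory Submission
  imports Defs "HOL-Real_Asymp.Real_Asymp"
begin

section \<open>Null sets of Hausdorff measure\<close>

lemma hausdorff_dim_le:
  assumes "0 \<le> s" "hausdorff_measure s A = 0"
  shows "hausdorff_dim A \<le> ennreal s"
  unfolding hausdorff_dim_def using assms by (intro Inf_lower) auto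

text \<open>Working form of nullity: it unfolds the supremum over \<delta> and the infimum over
  covers, so that null sets can be handled by exhibiting cheap covers.\<close>

lemma hausdorff_measure_eq_0_iff:
  "hausdorff_measure s A = 0 \<longleftrightarrow>
     (\<forall>\<delta>>0. \<forall>\<epsilon>>0. \<exists>U\<in>hausdorff_covers \<delta> A. (\<Sum>i. diam_pow s (U i)) < \<epsilon>)"
proof -
  have "hausdorff_measure s A = 0 \<longleftrightarrow> (\<forall>\<delta>>0. hausdorff_premeasure s \<delta> A = 0)"
    unfolding hausdorff_measure_def
    by (subst bot_ennreal [symmetric], subst SUP_bot_conv(1)) (auto simp: bot_ennreal)
  also have "\<dots> \<longleftrightarrow> (\<forall>\<delta>>0. \<forall>\<epsilon>>0. \<exists>U\<in>hausdorff_covers \<delta> A. (\<Sum>i. diam_pow s (U i)) < \<epsilon>)"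
  proof -
    have "hausdorff_premeasure s \<delta> A = 0 \<longleftrightarrow>
        (\<forall>\<epsilon>>0. \<exists>U\<in>hausdorff_covers \<delta> A. (\<Sum>i. diam_pow s (U i)) < \<epsilon>)" for \<delta>
      unfolding hausdorff_premeasure_def
      by (subst bot_ennreal [symmetric], subst INF_eq_bot_iff) (auto simp: bot_ennreal)
    then show ?thesis by simp
  qed
  finally show ?thesis .
qed

text \<open>Cover the n-th set at cost below \<open>e / 2 ^ Suc n\<close> and merge all these covers
  into one sequence; the costs add up to at most \<open>e\<close>.\<close>

lemma hausdorff_measure_UN_eq_0:
  fixes A :: "nat \<Rightarrow> 'a::metric_space set"
  assumes "\<And>n. hausdorff_measure s (A n) = 0"
  shows "hausdorff_measure s (\<Union>n. A n) = 0"
  unfolding hausdorff_measure_eq_0_iff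
proof (intro allI impI)
  fix \<delta> :: real and \<epsilon> :: ennreal
  assume \<delta>: "\<delta> > 0" and "\<epsilon> > 0"
  \<comment> \<open>\<epsilon> may be infinite; a value strictly between 0 and \<epsilon> is finite
    and can be split as a real geometric series.\<close>
  obtain \<eta> where \<eta>: "0 < \<eta>" "\<eta> < \<epsilon>" using dense[OF \<open>\<epsilon> > 0\<close>] by (elim exE conjE)
  have \<eta>top: "\<eta> < top" using \<eta>(2) by (rule order_less_le_trans) simp
  define e where "e = enn2real \<eta>"
  have e: "e > 0" "\<eta> = ennreal e" using \<eta> \<eta>top by (auto simp: e_def enn2real_positive_iff)
  have "\<exists>U\<in>hausdorff_covers \<delta> (A n). (\<Sum>i. diam_pow s (U i)) < ennreal (e * (1/2)^Suc n)" for n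
    using assms[of n] \<delta> e(1) unfolding hausdorff_measure_eq_0_iff by (auto simp: ennreal_less_zero_iff)
  then obtain U where U: "\<And>n. U n \<in> hausdorff_covers \<delta> (A n)"
    "\<And>n. (\<Sum>i. diam_pow s (U n i)) < ennreal (e * (1/2)^Suc n)"
    by metis
  define V where "V i = (case prod_decode i of (n, j) \<Rightarrow> U n j)" for i
  have "(\<Union>n. A n) \<subseteq> (\<Union>i. V i)"
  proof
    fix x assume "x \<in> (\<Union>n. A n)"
    then obtain n j where "x \<in> U n j" using U(1) unfolding hausdorff_covers_def by blast
    then have "x \<in> V (prod_encode (n, j))" by (simp add: V_def)
    then show "x \<in> (\<Union>i. V i)" by blast
  qed
  moreover have "bounded (V i) \<and> diameter (V i) \<le> \<delta>" for i
    using U(1) by (auto simp: V_def hausdorff_covers_def split: prod.split)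
  ultimately have V: "V \<in> hausdorff_covers \<delta> (\<Union>n. A n)" by (auto simp: hausdorff_covers_def)
  have "(\<Sum>i. diam_pow s (V i)) = (\<Sum>i. (\<lambda>(n,j). diam_pow s (U n j)) (prod_decode i))"
    by (simp add: V_def case_prod_beta)
  also have "\<dots> = (\<Sum>n. \<Sum>j. diam_pow s (U n j))"
    by (subst suminf_ennreal_2dimen[where g="\<lambda>n. \<Sum>j. diam_pow s (U n j)" and f="\<lambda>(n,j). diam_pow s (U n j)"])
       (auto simp: comp_def)
  also have "\<dots> \<le> (\<Sum>n. ennreal (e * (1/2)^Suc n))"
    using U(2) by (intro suminf_le) (auto intro: less_imp_le)
  also have "\<dots> = ennreal e"
  proof (rule suminf_ennreal_eq)
    show "(\<lambda>n. e * (1/2)^Suc n) sums e"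
      using sums_mult[OF power_half_series, of e] by simp
  qed (use e in auto)
  finally show "\<exists>U\<in>hausdorff_covers \<delta> (\<Union>n. A n). (\<Sum>i. diam_pow s (U i)) < \<epsilon>"
    using V \<eta> e by (intro bexI[of _ V]) auto
qed

lemma hausdorff_measure_mono_0:
  assumes "hausdorff_measure s B = 0" "A \<subseteq> B"
  shows "hausdorff_measure s A = 0"
proof -
  have "hausdorff_covers \<delta> B \<subseteq> hausdorff_covers \<delta> A" for \<delta>
    using assms(2) by (auto simp: hausdorff_covers_def)
  then show ?thesis using assms(1) unfolding hausdorff_measure_eq_0_iff by (meson subsetD)
qed

text \<open>The level-n cover has at most \<open>K * q ^ n\<close> intervals of length
  \<open>B ^ -n\<close>, so it costs at most \<open>K * (q / B powr s) ^ n\<close>, which tends to 0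
  because \<open>q < B powr s\<close>.\<close>

lemma hausdorff_measure_eq_0_grid:
  fixes A :: "real set"
  assumes "s > 0" "B > 1" "0 \<le> q" "q < B powr s" "0 \<le> K"
    and P: "\<And>n. finite (P n)" "\<And>n. real (card (P n)) \<le> K * q ^ n"
    and A: "\<And>n. A \<subseteq> (\<Union>p\<in>P n. {real_of_int p / B ^ n..(real_of_int p + 1) / B ^ n})"
  shows "hausdorff_measure s A = 0"
  unfolding hausdorff_measure_eq_0_iff
proof (intro allI impI)
  fix \<delta> :: real and \<epsilon> :: ennreal
  assume \<delta>: "\<delta> > 0" and \<epsilon>: "\<epsilon> > 0"
  have "(\<lambda>n. K * (q / B powr s) ^ n) \<longlonglongrightarrow> K * 0"
    using assms by (intro tendsto_intros LIMSEQ_power_zero) (auto simp: field_simps)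
  then have "(\<lambda>n. ennreal (K * (q / B powr s) ^ n)) \<longlonglongrightarrow> ennreal 0"
    by (intro tendsto_ennrealI) simp
  then have ev1: "eventually (\<lambda>n. ennreal (K * (q / B powr s) ^ n) < \<epsilon>) sequentially"
    using order_tendstoD(2) \<epsilon> by fastforce
  have "(\<lambda>n. (1 / B) ^ n) \<longlonglongrightarrow> 0"
    using assms by (intro LIMSEQ_power_zero) auto
  then have ev2: "eventually (\<lambda>n. (1 / B) ^ n < \<delta>) sequentially"
    using \<delta> by (rule order_tendstoD)
  \<comment> \<open>One level serves both demands: total cost below \<epsilon> and mesh below
    \<delta>.\<close>
  from eventually_conj[OF ev1 ev2] obtain n where n: "ennreal (K * (q / B powr s) ^ n) < \<epsilon>" "(1 / B) ^ n < \<delta>"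
    by (auto simp: eventually_sequentially)
  obtain g where g: "bij_betw g {..<card (P n)} (P n)"
    using ex_bij_betw_nat_finite[OF P(1), of n] by (auto simp: atLeast0LessThan)
  define I where "I p = {real_of_int p / B ^ n..(real_of_int p + 1) / B ^ n}" for p
  \<comment> \<open>The finite cover is padded with empty sets, which cost 0.\<close>
  define U where "U i = (if i < card (P n) then I (g i) else {})" for i
  have diamI: "diameter (I p) = (1/B)^n" for p
    using assms by (simp add: I_def diameter_closed_interval divide_right_mono add_divide_distrib power_divide)
  have "A \<subseteq> (\<Union>i. U i)"
  proof
    fix x assume "x \<in> A"
    then obtain p where p: "p \<in> P n" "x \<in> I p" using A[of n] by (auto simp: I_def)
    then obtain i where "i < card (P n)" "p = g i" using g by (auto simp: bij_betw_def)
    then show "x \<in> (\<Union>i. U i)" using p by (auto simp: U_def)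
  qed
  moreover have "bounded (U i) \<and> diameter (U i) \<le> \<delta>" for i
    using n \<delta> by (auto simp: U_def diamI) (auto simp: I_def)
  ultimately have U: "U \<in> hausdorff_covers \<delta> A" by (auto simp: hausdorff_covers_def)
  have Ine: "I p \<noteq> {}" for p using assms by (auto simp: I_def divide_right_mono)
  have "(\<Sum>i. diam_pow s (U i)) = (\<Sum>i<card (P n). diam_pow s (U i))"
    by (intro suminf_finite) (auto simp: U_def diam_pow_def)
  also have "\<dots> = (\<Sum>i<card (P n). ennreal (((1/B)^n) powr s))"
    using assms Ine by (intro sum.cong) (auto simp: U_def diam_pow_def diamI)
  also have "\<dots> = ennreal (real (card (P n)) * ((1/B)^n) powr s)"
    by (simp add: ennreal_mult ennreal_of_nat_eq_real_of_nat)
  also have "\<dots> \<le> ennreal (K * q ^ n * ((1/B)^n) powr s)"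
    using P(2) by (intro ennreal_leI mult_right_mono) auto
  also have "((1/B)^n) powr s = (1 / B powr s)^n"
    using assms by (simp add: powr_realpow[symmetric] powr_powr powr_divide powr_minus_divide mult.commute power_one_over)
  also have "K * q ^ n * (1 / B powr s)^n = K * (q / B powr s) ^ n"
    by (simp add: power_divide)
  finally show "\<exists>U\<in>hausdorff_covers \<delta> A. (\<Sum>i. diam_pow s (U i)) < \<epsilon>"
    using U n by (intro bexI[of _ U]) auto
qed

section \<open>Iterates of \<open>T_map\<close> as fractional parts\<close>

lemma frac_of_nat_mult_frac: "frac (real m * frac x) = frac (real m * x)"
proof -
  have "real m * x = of_int (int m * \<lfloor>x\<rfloor>) + real m * frac x"
    by (simp add: frac_def algebra_simps)
  then show ?thesis by (metis frac_add_of_int_left)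
qed

lemma frac_of_nat_power_mult_frac: "frac (real m ^ n * frac x) = frac (real m ^ n * x)"
  using frac_of_nat_mult_frac[of "m ^ n" x] by simp

text \<open>The integer part discarded at each iteration is later multiplied by a power of
  \<open>b\<close>, so it stays an integer and disappears modulo 1.\<close>

lemma T_map_funpow:
  assumes "0 \<le> x" "x < 1"
  shows "(T_map b ^^ n) x = frac (real b ^ n * x)"
proof (induction n)
  case 0
  then show ?case using assms by (simp add: frac_eq)
next
  case (Suc n)
  then show ?case by (simp add: T_map_def frac_of_nat_mult_frac mult.assoc)
qed

section \<open>Upper bounds for the dimension by grid covers\<close>

text \<open>For every \<open>t > 1\<close> the dyadic grid of level n costs \<open>2 ^ n\<close>
  times \<open>2 powr (- n * t)\<close>, which tends to 0; then t is let tend to 1.\<close>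

lemma hausdorff_dim_unit_interval_le:
  assumes "A \<subseteq> {0..<1::real}"
  shows "hausdorff_dim A \<le> 1"
proof -
  have "hausdorff_dim A \<le> ennreal t" if t: "t > 1" for t :: real
  proof (rule hausdorff_dim_le)
    show "hausdorff_measure t A = 0"
    proof (rule hausdorff_measure_eq_0_grid[where B=2 and q=2 and K=1 and P="\<lambda>n. {0..<2^n}"])
      show "2 < 2 powr t" using powr_less_mono[of 1 t 2] t by simp
      show "A \<subseteq> (\<Union>p\<in>{0..<2^n}. {real_of_int p / 2 ^ n..(real_of_int p + 1) / 2 ^ n})" for n
      proof
        fix x assume "x \<in> A"
        then have x: "0 \<le> x" "x < 1" using assms by auto
        then have "\<lfloor>2^n * x\<rfloor> \<in> {0..<2^n}" by (auto simp: floor_less_iff)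
        moreover have "real_of_int \<lfloor>2^n * x\<rfloor> / 2 ^ n \<le> x" "x \<le> (real_of_int \<lfloor>2^n * x\<rfloor> + 1) / 2 ^ n"
          by (auto simp: field_simps) linarith+
        ultimately show "x \<in> (\<Union>p\<in>{0..<2^n}. {real_of_int p / 2 ^ n..(real_of_int p + 1) / 2 ^ n})"
          by (intro UN_I) auto
      qed
    qed (use t in auto)
  qed (use t in auto)
  note le = this
  show ?thesis
  proof (rule ennreal_le_epsilon)
    fix e :: real assume "e > 0"
    then show "hausdorff_dim A \<le> 1 + ennreal e" using le[of "1 + e"] by simp
  qed
qed

text \<open>Forbidding one digit from position \<open>N\<close> on leaves at most
  \<open>B ^ N * (B - 1) ^ n\<close> prefixes of length n, and \<open>B - 1 < B powr t\<close> makes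
  the grid covers by their cylinders arbitrarily cheap.\<close>

lemma hausdorff_measure_missing_digit_eq_0:
  fixes B :: nat
  assumes B: "B \<ge> 2" "w \<in> {0..<int B}" and t: "t > 0" "real B - 1 < real B powr t"
  shows "hausdorff_measure t
    {x\<in>{0..<1}. \<forall>j\<ge>N. \<lfloor>real B * frac (real B ^ j * x)\<rfloor> \<noteq> w} = 0" (is "hausdorff_measure t ?A = 0")
proof -
  define D where "D n = (if n < N then {0..<int B} else {0..<int B} - {w})" for n
  define P where "P = rec_nat {0::int} (\<lambda>n Q. (\<lambda>(p, d). int B * p + d) ` (Q \<times> D n))"
  have P0: "P 0 = {0}" and PS: "P (Suc n) = (\<lambda>(p, d). int B * p + d) ` (P n \<times> D n)" for n
    by (simp_all add: P_def)
  have finD: "finite (D n)" for n by (simp add: D_def)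
  have cardD: "card (D n) \<le> (if n < N then B else B - 1)" for n using B by (simp add: D_def)
  have fin: "finite (P n)" for n by (induction n) (auto simp: P0 PS finD)
  have card1: "card (P n) \<le> B ^ n" for n
  proof (induction n)
    case (Suc n)
    have "card (P (Suc n)) \<le> card (P n) * card (D n)"
      unfolding PS using card_image_le[of "P n \<times> D n"] fin finD by (simp add: card_cartesian_product)
    also have "\<dots> \<le> B ^ n * B" using Suc cardD[of n] by (intro mult_mono) (auto split: if_splits)
    finally show ?case by (simp add: mult.commute)
  qed (simp add: P0)
  have card2: "card (P (N + n)) \<le> B ^ N * (B - 1) ^ n" for n
  proof (induction n)
    case (Suc n)
    have "card (P (Suc (N + n))) \<le> card (P (N + n)) * card (D (N + n))"
      unfolding PS using card_image_le[of "P (N+n) \<times> D (N+n)"] fin finD by (simp add: card_cartesian_product)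
    also have "\<dots> \<le> (B ^ N * (B - 1) ^ n) * (B - 1)" using Suc cardD[of "N+n"] by (intro mult_mono) (auto split: if_splits)
    finally show ?case by (simp add: mult_ac)
  qed (simp add: card1)
  \<comment> \<open>The grid lemma needs one bound valid at every level, so the levels below
    \<open>N\<close> are absorbed into the constant \<open>B ^ N\<close>.\<close>
  have card3: "card (P n) \<le> B ^ N * (B - 1) ^ n" for n
  proof (cases "n < N")
    case True
    have "card (P n) \<le> B ^ n * 1" using card1 by simp
    also have "\<dots> \<le> B ^ N * (B - 1) ^ n"
      using True B by (intro mult_mono power_increasing) auto
    finally show ?thesis .
  next
    case False
    then have "card (P n) \<le> B ^ N * (B - 1) ^ (n - N)" using card2[of "n - N"] by simp
    also have "\<dots> \<le> B ^ N * (B - 1) ^ n"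
      using B by (intro mult_left_mono power_increasing) auto
    finally show ?thesis .
  qed
  \<comment> \<open>The integer part of \<open>B ^ n * x\<close> is the number formed by the first n
    digits of x.\<close>
  have mem: "\<lfloor>real B ^ n * x\<rfloor> \<in> P n" if "x \<in> ?A" for n x
  proof (induction n)
    case 0
    then show ?case using that by (auto simp: P0 floor_eq_iff)
  next
    case (Suc n)
    define z where "z = real B ^ n * x"
    have "real B * z = of_int (int B * \<lfloor>z\<rfloor>) + real B * frac z" by (simp add: frac_def algebra_simps)
    then have "\<lfloor>real B * z\<rfloor> = int B * \<lfloor>z\<rfloor> + \<lfloor>real B * frac z\<rfloor>" by linarith
    moreover have "\<lfloor>real B * frac z\<rfloor> \<in> D n"
      using that B frac_lt_1[of z] by (auto simp: D_def z_def floor_less_iff)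
    moreover have "real B ^ Suc n * x = real B * z" by (simp add: z_def)
    ultimately show ?case using Suc unfolding PS z_def[symmetric]
      by (intro image_eqI[where x="(\<lfloor>z\<rfloor>, \<lfloor>real B * frac z\<rfloor>)"]) (auto simp: mult.assoc)
  qed
  show ?thesis
  proof (rule hausdorff_measure_eq_0_grid[where B="real B" and q="real B - 1" and K="real B ^ N" and P=P])
    show "real (card (P n)) \<le> real B ^ N * (real B - 1) ^ n" for n
    proof -
      have "real (card (P n)) \<le> real (B ^ N * (B - 1) ^ n)" using card3 by (simp only: of_nat_le_iff)
      then show ?thesis using B by (simp add: of_nat_diff)
    qed
    show "?A \<subseteq> (\<Union>p\<in>P n. {real_of_int p / real B ^ n..(real_of_int p + 1) / real B ^ n})" for n
    proof
      fix x assume x: "x \<in> ?A"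
      have Bn: "real B ^ n > 0" using B by simp
      have "real_of_int \<lfloor>real B ^ n * x\<rfloor> \<le> real B ^ n * x" "real B ^ n * x \<le> real_of_int \<lfloor>real B ^ n * x\<rfloor> + 1"
        by linarith+
      then have "real_of_int \<lfloor>real B ^ n * x\<rfloor> / real B ^ n \<le> x" "x \<le> (real_of_int \<lfloor>real B ^ n * x\<rfloor> + 1) / real B ^ n"
        using Bn by (simp_all add: pos_divide_le_eq pos_le_divide_eq mult.commute)
      then show "x \<in> (\<Union>p\<in>P n. {real_of_int p / real B ^ n..(real_of_int p + 1) / real B ^ n})"
        using mem[OF x, of n] by (intro UN_I) auto
    qed
  qed (use B t fin in auto)
qed

lemma hausdorff_dim_E_set_less_1:
  assumes b: "b \<ge> 2" and \<epsilon>: "\<epsilon> > 0" and \<phi>: "\<forall>\<^sub>F n in sequentially. \<epsilon> \<le> \<phi> n"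
  shows "hausdorff_dim (E_set b \<phi>) < 1"
proof -
  obtain k0 where "1 / \<epsilon> < real b ^ k0" using real_arch_pow[of "real b" "1/\<epsilon>"] b by auto
  also have "\<dots> \<le> real b ^ Suc k0" using b by (intro power_increasing) auto
  finally obtain k where k: "1 / \<epsilon> < real b ^ k" "k > 0" by blast
  define B where "B = b ^ k"
  have B: "B \<ge> 2" unfolding B_def using b k by (intro le_trans[OF b self_le_power]) auto
  have B\<epsilon>: "1 / real B \<le> \<epsilon>" using k(1) B \<epsilon> by (simp add: B_def[symmetric] pos_divide_less_eq pos_divide_le_eq mult.commute flip: of_nat_power)
  \<comment> \<open>Any number strictly between \<open>B - 1\<close> and \<open>B\<close> would do
    in place of \<open>B - 1/2\<close>: its logarithm is below 1, yet \<open>B powr t\<close>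
    exceeds \<open>B - 1\<close>.\<close>
  define t where "t = log (real B) (real B - 1/2)"
  have t: "0 < t" "t < 1" "real B - 1 < real B powr t"
    using B by (auto simp: t_def log_less_one_cancel_iff)
  define A where "A N w = {x\<in>{0..<1}. \<forall>j\<ge>N. \<lfloor>real B * frac (real B ^ j * x)\<rfloor> \<noteq> w}" for N and w :: int
  \<comment> \<open>The finitely many digits are padded with empty sets to a union over all
    naturals, the form in which countable unions of null sets are available.\<close>
  have "E_set b \<phi> \<subseteq> (\<Union>N. \<Union>w. if w \<in> {..<B} then A N (int w) else {})"
  proof
    fix x assume "x \<in> E_set b \<phi>"
    then have x: "0 \<le> x" "x < 1" and ev: "\<forall>\<^sub>F n in sequentially. \<bar>(T_map b ^^ n) x - x\<bar> \<ge> \<phi> n"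
      by (auto simp: E_set_def)
    from \<phi> ev have "\<forall>\<^sub>F n in sequentially. \<bar>(T_map b ^^ n) x - x\<bar> \<ge> \<epsilon>"
      by eventually_elim linarith
    then obtain N where N: "\<And>n. n \<ge> N \<Longrightarrow> \<bar>(T_map b ^^ n) x - x\<bar> \<ge> \<epsilon>"
      by (auto simp: eventually_sequentially)
    \<comment> \<open>The missing digit is the first base-B digit of x itself: if it came first in
      \<open>frac (B ^ j * x)\<close> too, that orbit point would be within \<open>1 / B\<close>,
      hence within \<epsilon>, of x.\<close>
    define w where "w = nat \<lfloor>real B * x\<rfloor>"
    have w0: "int w = \<lfloor>real B * x\<rfloor>" using x by (simp add: w_def)
    have "real B * x < real B" using x B by simp
    then have w: "w < B" using w0 by linarith
    have "\<lfloor>real B * frac (real B ^ j * x)\<rfloor> \<noteq> int w" if j: "j \<ge> N" for j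
    proof
      assume "\<lfloor>real B * frac (real B ^ j * x)\<rfloor> = int w"
      then have "\<bar>real B * frac (real B ^ j * x) - real B * x\<bar> < 1" unfolding w0 by linarith
      then have "real B * \<bar>frac (real B ^ j * x) - x\<bar> < 1"
        by (simp add: right_diff_distrib[symmetric] abs_mult)
      then have "\<bar>frac (real B ^ j * x) - x\<bar> < 1 / real B" using B by (simp add: field_simps)
      moreover have "(T_map b ^^ (k * j)) x = frac (real B ^ j * x)"
        using x by (simp add: T_map_funpow B_def power_mult)
      moreover have "k * j \<ge> N" using k by (intro le_trans[OF j]) simp
      ultimately show False using N[of "k*j"] B\<epsilon> by simp
    qed
    then have "x \<in> A N (int w)" using x by (simp add: A_def)
    then show "x \<in> (\<Union>N. \<Union>w. if w \<in> {..<B} then A N (int w) else {})" using w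
      by (intro UN_I[of N] UN_I[of w]) auto
  qed
  moreover have "hausdorff_measure t (\<Union>N. \<Union>w. if w \<in> {..<B} then A N (int w) else {}) = 0"
  proof (intro hausdorff_measure_UN_eq_0)
    fix N w
    have "hausdorff_measure t (A N (int w)) = 0" if "w < B"
      unfolding A_def by (rule hausdorff_measure_missing_digit_eq_0) (use that B t in auto)
    moreover have "hausdorff_measure t ({} :: real set) = 0"
    proof (rule hausdorff_measure_mono_0)
      show "hausdorff_measure t (A 0 0) = 0"
        unfolding A_def by (rule hausdorff_measure_missing_digit_eq_0) (use B t in auto)
    qed auto
    ultimately show "hausdorff_measure t (if w \<in> {..<B} then A N (int w) else {}) = 0" by auto
  qed
  ultimately have "hausdorff_measure t (E_set b \<phi>) = 0" by (rule hausdorff_measure_mono_0[rotated])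
  then have "hausdorff_dim (E_set b \<phi>) \<le> ennreal t" using t by (intro hausdorff_dim_le) auto
  also have "\<dots> < 1" using t by (simp add: ennreal_less_one_iff)
  finally show ?thesis .
qed

section \<open>Lower bounds for the dimension from inverse Hoelder maps\<close>

text \<open>Lebesgue measure serves as the mass distribution. Pulling back a cover of
  \<open>E\<close> along \<open>h\<close> covers the unit interval by sets inside balls of radius
  \<open>C * diameter powr s\<close>; a cover that is too cheap would give total length below
  1.\<close>

lemma hausdorff_dim_ge_of_inverse_holder:
  fixes h :: "real \<Rightarrow> real"
  assumes s: "0 < s" and C: "0 < C" and h: "h ` {0..<1} \<subseteq> E"
    and hol: "\<And>x y. x \<in> {0..<1} \<Longrightarrow> y \<in> {0..<1} \<Longrightarrow> \<bar>x - y\<bar> \<le> C * \<bar>h x - h y\<bar> powr s"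
  shows "ennreal s \<le> hausdorff_dim E"
  unfolding hausdorff_dim_def
proof (rule Inf_greatest, clarsimp)
  fix t :: real assume t: "0 \<le> t" and H: "hausdorff_measure t E = 0"
  show "s \<le> t"
  proof (rule ccontr)
    assume "\<not> ?thesis"
    then have ts: "t < s" by simp
    \<comment> \<open>Diameters at most 1 make the exponent \<open>s\<close> no more expensive than
      \<open>t < s\<close>; the bound \<open>1 / (2 * C)\<close> compensates the factor
      \<open>2 * C\<close> of the ball lengths.\<close>
    obtain U where U: "U \<in> hausdorff_covers 1 E" "(\<Sum>i. diam_pow t (U i)) < ennreal (1 / (2 * C))"
    proof -
      have "0 < ennreal (1 / (2 * C))" using C by simp
      then show ?thesis using H that zero_less_one unfolding hausdorff_measure_eq_0_iff by blast
    qed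
    define V where "V i = {y\<in>{0..<1}. h y \<in> U i}" for i
    \<comment> \<open>The preimage \<open>V i\<close> may fail to be measurable, so it is replaced
      by a ball around one of its points.\<close>
    define W where "W i = (if V i = {} then {} else cball (SOME y. y \<in> V i) (C * diameter (U i) powr s))" for i
    have bd: "bounded (U i)" "diameter (U i) \<le> 1" for i using U(1) by (auto simp: hausdorff_covers_def)
    have VW: "V i \<subseteq> W i" for i
    proof
      fix y assume y: "y \<in> V i"
      define z where "z = (SOME y. y \<in> V i)"
      have z: "z \<in> V i" unfolding z_def using y by (rule someI)
      have "\<bar>h z - h y\<bar> \<le> diameter (U i)"
        using diameter_bounded_bound[OF bd(1)] y z by (auto simp: V_def dist_real_def)
      then have "C * \<bar>h z - h y\<bar> powr s \<le> C * diameter (U i) powr s"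
        using C s by (intro mult_left_mono powr_mono2) auto
      then have "\<bar>z - y\<bar> \<le> C * diameter (U i) powr s"
        using hol[of z y] y z by (auto simp: V_def)
      then show "y \<in> W i" using y by (auto simp: W_def z_def dist_real_def)
    qed
    have Wsets: "W i \<in> sets lborel" for i by (simp add: W_def)
    have em: "emeasure lborel (W i) \<le> ennreal (2 * C) * diam_pow t (U i)" for i
    proof (cases "V i = {}")
      case False
      then have Une: "U i \<noteq> {}" by (auto simp: V_def)
      define d where "d = diameter (U i)"
      have d: "0 \<le> d" "d \<le> 1" using bd[of i] by (auto simp: d_def diameter_ge_0)
      have "emeasure lborel (W i) = ennreal (2 * C * d powr s)"
        using False C by (simp add: W_def cball_eq_atLeastAtMost d_def)
      also have "\<dots> = ennreal (2 * C) * ennreal (d powr s)" using C by (intro ennreal_mult) auto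
      also have "ennreal (d powr s) \<le> diam_pow t (U i)"
      \<comment> \<open>For exponent 0 a nonempty set costs 1 by convention, even when its diameter
        is 0.\<close>
      proof (cases "t = 0")
        case True
        have "d powr s \<le> 1" using d s by (simp add: powr_le1)
        then show ?thesis using True Une by (simp add: diam_pow_def)
      next
        case False
        have "d powr s \<le> d powr t" using d ts by (intro powr_mono') auto
        then show ?thesis using False Une by (simp add: diam_pow_def d_def[symmetric] ennreal_leI)
      qed
      finally show ?thesis by (simp add: mult_left_mono)
    qed (simp add: W_def)
    have "{0..<1} \<subseteq> (\<Union>i. W i)"
    proof
      fix y :: real assume y: "y \<in> {0..<1}"
      then have "h y \<in> (\<Union>i. U i)" using h U(1) unfolding hausdorff_covers_def by blast
      then show "y \<in> (\<Union>i. W i)" using y VW by (force simp: V_def)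
    qed
    then have "emeasure lborel {0..<1::real} \<le> emeasure lborel (\<Union>i. W i)"
      using Wsets by (intro emeasure_mono sets.countable_UN) auto
    also have "\<dots> \<le> (\<Sum>i. emeasure lborel (W i))"
      using Wsets by (intro emeasure_subadditive_countably) auto
    also have "\<dots> \<le> (\<Sum>i. ennreal (2 * C) * diam_pow t (U i))"
      using em by (intro suminf_le) auto
    also have "\<dots> = ennreal (2 * C) * (\<Sum>i. diam_pow t (U i))" by (rule ennreal_suminf_cmult)
    also have "\<dots> < ennreal (2 * C) * ennreal (1 / (2 * C))"
      using U(2) C by (intro ennreal_mult_strict_left_mono) auto
    also have "\<dots> = 1" using C by (subst ennreal_mult[symmetric]) auto
    finally show False by simp
  qed
qed

section \<open>A Cantor set in base B as a recoding of the unit interval\<close>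

text \<open>Reads the base-q digits of y, shifted by one, in base B. For \<open>B \<ge> q + 2\<close> the image is a Cantor
  set all of whose digits lie strictly between 0 and \<open>B - 1\<close>.\<close>
definition redigit :: "nat \<Rightarrow> nat \<Rightarrow> real \<Rightarrow> real" where
  "redigit q B y = (\<Sum>i. (real_of_int \<lfloor>real q * frac (real q ^ i * y)\<rfloor> + 1) / real B ^ Suc i)"

context
  fixes q B :: nat
  assumes q: "q \<ge> 1" and B: "B \<ge> q + 2"
begin

lemma floor_digit_bounds:
  "0 \<le> real_of_int \<lfloor>real q * frac z\<rfloor>" "real_of_int \<lfloor>real q * frac z\<rfloor> + 1 \<le> real q"
proof -
  have "real q * frac z < real q" using q frac_lt_1[of z] by simp
  then have "\<lfloor>real q * frac z\<rfloor> < int q" by linarith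
  then show "real_of_int \<lfloor>real q * frac z\<rfloor> + 1 \<le> real q" by linarith
qed auto

lemma redigit_majorant_sums: "(\<lambda>i. real q / real B ^ Suc i) sums (real q / (real B - 1))"
proof -
  have "(\<lambda>i. real q / real B * (1 / real B) ^ i) sums (real q / real B * (1 / (1 - 1 / real B)))"
    using B by (intro sums_mult geometric_sums) auto
  moreover have "real q / real B * (1 / (1 - 1 / real B)) = real q / (real B - 1)"
    using B by (simp add: field_simps)
  moreover have "(\<lambda>i. real q / real B * (1 / real B) ^ i) = (\<lambda>i. real q / real B ^ Suc i)"
    by (simp add: power_divide)
  ultimately show ?thesis by (simp only:)
qed

lemma redigit_summable:
  "summable (\<lambda>i. (real_of_int \<lfloor>real q * frac (real q ^ i * y)\<rfloor> + 1) / real B ^ Suc i)"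
proof (rule summable_comparison_test')
  show "summable (\<lambda>i. real q / real B ^ Suc i)" using redigit_majorant_sums by (rule sums_summable)
  show "norm ((real_of_int \<lfloor>real q * frac (real q ^ i * y)\<rfloor> + 1) / real B ^ Suc i) \<le> real q / real B ^ Suc i"
    for i using floor_digit_bounds[of "real q ^ i * y"]
    by (simp add: divide_right_mono del: power_Suc)
qed

lemma redigit_nonneg: "0 \<le> redigit q B y"
  unfolding redigit_def using redigit_summable floor_digit_bounds(1)
  by (intro suminf_nonneg) (auto intro!: divide_nonneg_nonneg add_nonneg_nonneg)

lemma redigit_le: "redigit q B y \<le> 1 - 1 / real B"
proof -
  have "redigit q B y \<le> (\<Sum>i. real q / real B ^ Suc i)"
    unfolding redigit_def using redigit_summable floor_digit_bounds(2) redigit_majorant_sums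
    by (intro suminf_le divide_right_mono) (auto simp del: power_Suc intro: sums_summable)
  also have "\<dots> = real q / (real B - 1)" using redigit_majorant_sums by (rule sums_unique[symmetric])
  \<comment> \<open>This is where \<open>B \<ge> q + 2\<close> enters: shifted digits are at most
    \<open>B - 2\<close>.\<close>
  also have "\<dots> \<le> (real B - 2) / (real B - 1)" using B by (intro divide_right_mono) auto
  also have "\<dots> \<le> 1 - 1 / real B" using B by (simp add: field_simps)
  finally show ?thesis .
qed

text \<open>Splits off the first digit; the remaining series is that of the shifted point
  \<open>frac (q * y)\<close>, scaled by \<open>1 / B\<close>.\<close>

lemma redigit_rec:
  "real B * redigit q B y = real_of_int \<lfloor>real q * frac y\<rfloor> + 1 + redigit q B (frac (real q * y))"
proof -
  let ?t = "\<lambda>y i. (real_of_int \<lfloor>real q * frac (real q ^ i * y)\<rfloor> + 1) / real B ^ Suc i"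
  have shift: "?t y (Suc i) = ?t (frac (real q * y)) i / real B" for i
    by (simp add: frac_of_nat_power_mult_frac mult_ac)
  have "redigit q B y = ?t y 0 + (\<Sum>i. ?t y (Suc i))"
    unfolding redigit_def using suminf_split_head[OF redigit_summable[of y]] by simp
  also have "(\<Sum>i. ?t y (Suc i)) = redigit q B (frac (real q * y)) / real B"
    unfolding redigit_def shift by (rule suminf_divide[OF redigit_summable])
  finally show ?thesis using B by (simp add: field_simps)
qed

lemma redigit_ge: "1 / real B \<le> redigit q B y"
  using redigit_rec[of y] redigit_nonneg[of "frac (real q * y)"] floor_digit_bounds(1)[of y] B
  by (simp add: field_simps)

lemma redigit_less_1: "redigit q B y < 1"
proof -
  have "1 / real B > 0" using B by simp
  then show ?thesis using redigit_le[of y] by linarith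
qed

text \<open>\<open>redigit\<close> intertwines multiplication by q modulo 1 with multiplication by B
  modulo 1: one step of the recursion removes an integer, and the rest already lies in
  [0,1).\<close>

lemma frac_power_redigit: "frac (real B ^ n * redigit q B y) = redigit q B (frac (real q ^ n * y))"
proof (induction n arbitrary: y)
  case 0
  have "redigit q B (frac y) = redigit q B y"
    by (simp add: redigit_def frac_of_nat_power_mult_frac)
  then show ?case using redigit_nonneg redigit_less_1 by (simp add: frac_eq)
next
  case (Suc n)
  have "frac (real B ^ Suc n * redigit q B y) = frac (real B ^ n * frac (real B * redigit q B y))"
    by (simp add: frac_of_nat_power_mult_frac mult_ac)
  also have "frac (real B * redigit q B y) = redigit q B (frac (real q * y))"
  proof -
    have "frac (real B * redigit q B y) = frac (redigit q B (frac (real q * y)) + of_int (\<lfloor>real q * frac y\<rfloor> + 1))"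
      unfolding redigit_rec by (simp add: add_ac)
    also have "\<dots> = frac (redigit q B (frac (real q * y)))" by (rule frac_add_of_int_right)
    finally show ?thesis using redigit_nonneg redigit_less_1 by (simp add: frac_eq)
  qed
  finally show ?case by (simp add: Suc frac_of_nat_power_mult_frac mult_ac)
qed

text \<open>Since the digits 0 and \<open>B - 1\<close> do not occur, points whose first digits differ are at least
  \<open>2 / B\<^sup>2\<close> apart, even when these digits are adjacent.\<close>
lemma redigit_close_imp_close:
  assumes "y \<in> {0..<1}" "z \<in> {0..<1}" "\<bar>redigit q B y - redigit q B z\<bar> < 1 / real B ^ Suc n"
  shows "\<bar>y - z\<bar> \<le> 1 / real q ^ n"
  using assms
proof (induction n arbitrary: y z)
  case (Suc n)
  define d where "d x = \<lfloor>real q * frac x\<rfloor>" for x :: real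
  define r where "r x = redigit q B (frac (real q * x))" for x
  have "real B * \<bar>redigit q B y - redigit q B z\<bar> < 1 / real B ^ Suc n"
    using Suc.prems(3) B by (simp add: field_simps)
  then have "\<bar>real B * redigit q B y - real B * redigit q B z\<bar> < 1 / real B ^ Suc n"
    by (simp add: right_diff_distrib[symmetric] abs_mult)
  then have *: "\<bar>(of_int (d y) - of_int (d z)) + (r y - r z)\<bar> < 1 / real B ^ Suc n"
    unfolding redigit_rec d_def r_def by (simp add: algebra_simps)
  have "1 / real B ^ Suc n \<le> 1 / real B"
    using B power_increasing[of 1 "Suc n" "real B"] by (intro divide_left_mono) auto
  then have "\<bar>(of_int (d y) - of_int (d z)) + (r y - r z)\<bar> < 1 / real B" using * by linarith
  moreover have "\<bar>r y - r z\<bar> \<le> 1 - 2 / real B"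
    using redigit_ge[of "frac (real q * y)"] redigit_ge[of "frac (real q * z)"]
      redigit_le[of "frac (real q * y)"] redigit_le[of "frac (real q * z)"] by (simp add: r_def abs_le_iff)
  moreover have "1 / real B > 0" using B by simp
  ultimately have "\<bar>real_of_int (d y) - of_int (d z)\<bar> < 1" by (simp add: abs_less_iff abs_le_iff)
  then have deq: "d y = d z" by linarith
  have "\<bar>frac (real q * y) - frac (real q * z)\<bar> \<le> 1 / real q ^ n"
    using * by (intro Suc.IH) (auto simp: frac_lt_1 deq r_def)
  \<comment> \<open>Equal first digits mean that the same integer is subtracted from both points, so
    their distance is scaled exactly by q.\<close>
  moreover have "frac (real q * y) = real q * y - d y" "frac (real q * z) = real q * z - d z"
    using Suc.prems by (auto simp: frac_def[of "real q * y"] frac_def[of "real q * z"] d_def frac_eq[THEN iffD2])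
  ultimately have "\<bar>real q * y - real q * z\<bar> \<le> 1 / real q ^ n" by (simp add: deq)
  then have "real q * \<bar>y - z\<bar> \<le> 1 / real q ^ n"
    by (simp add: right_diff_distrib[symmetric] abs_mult)
  then show ?case using q by (simp add: field_simps)
qed auto

text \<open>Let n be least with the distance of the images at least \<open>1 / B ^ Suc n\<close>.
  Minimality gives \<open>\<bar>y - z\<bar> \<le> q / q ^ n\<close>, and \<open>B powr s = q\<close>
  turns this into the Hoelder bound; the factor \<open>q ^ 2\<close> pays for the two index
  shifts.\<close>

lemma redigit_inverse_holder:
  assumes yz: "y \<in> {0..<1}" "z \<in> {0..<1}" and q2: "q \<ge> 2"
  shows "\<bar>y - z\<bar> \<le> real q ^ 2 * \<bar>redigit q B y - redigit q B z\<bar> powr log (real B) (real q)"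
proof -
  define \<rho> where "\<rho> = \<bar>redigit q B y - redigit q B z\<bar>"
  define s where "s = log (real B) (real q)"
  have s: "real B powr s = real q" "s > 0" using B q2 by (auto simp: s_def)
  show ?thesis
  proof (cases "y = z")
    case False
    have "\<exists>n. \<not> \<rho> < 1 / real B ^ Suc n"
    proof (rule ccontr)
      assume "\<not> ?thesis"
      then have "\<bar>y - z\<bar> \<le> 1 / real q ^ n" for n
        using redigit_close_imp_close[OF yz] by (auto simp: \<rho>_def)
      moreover obtain n where "1 / \<bar>y - z\<bar> < real q ^ n" using real_arch_pow[of "real q"] q2 by auto
      ultimately have "\<bar>y - z\<bar> * real q ^ n \<le> 1" "1 < real q ^ n * \<bar>y - z\<bar>"
        using False q2 by (simp_all add: pos_le_divide_eq pos_divide_less_eq)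
      then show False by (simp add: mult.commute)
    qed
    then obtain n where n: "\<not> \<rho> < 1 / real B ^ Suc n" "\<And>m. m < n \<Longrightarrow> \<rho> < 1 / real B ^ Suc m"
      using exists_least_iff[of "\<lambda>n. \<not> \<rho> < 1 / real B ^ Suc n"] by auto
    have "\<bar>y - z\<bar> \<le> real q / real q ^ n"
    proof (cases n)
      \<comment> \<open>No smaller index is available here; the trivial bound by 1 suffices.\<close>
      case 0
      then show ?thesis using yz q by auto
    next
      case (Suc m)
      then have "\<rho> < 1 / real B ^ Suc m" using n(2) by auto
      then have "\<bar>y - z\<bar> \<le> 1 / real q ^ m" using redigit_close_imp_close[OF yz] by (auto simp: \<rho>_def)
      then show ?thesis using Suc q by simp
    qed
    also have "\<dots> = real q ^ 2 * (1 / real B ^ Suc n) powr s"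
    proof -
      have "(1 / real B ^ Suc n) powr s = 1 / (real B ^ Suc n) powr s"
        using B by (simp add: powr_divide del: power_Suc)
      also have "(real B ^ Suc n) powr s = (real B powr s) ^ Suc n"
        using B by (simp add: powr_realpow[symmetric] powr_powr mult.commute del: power_Suc of_nat_Suc)
      finally show ?thesis using s q by (simp add: field_simps power2_eq_square)
    qed
    also have "\<dots> \<le> real q ^ 2 * \<rho> powr s"
      using n(1) s by (intro mult_left_mono powr_mono2) auto
    finally show ?thesis by (simp add: \<rho>_def s_def)
  qed auto
qed

end

section \<open>Full dimension when \<phi> tends to 0\<close>

text \<open>Prefixing three zero digits to a point of the Cantor set puts it within \<open>B\<^sup>-\<^sup>3\<close> of 0, while
  from then on its orbit stays above \<open>B\<^sup>-\<^sup>2\<close>.\<close>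
lemma redigit_in_E_set:
  fixes b k q :: nat
  assumes b: "b \<ge> 2" and k: "k \<ge> 1" and q: "q \<ge> 1" "b ^ k = q + 2" and \<phi>: "\<phi> \<longlonglongrightarrow> 0"
  shows "redigit q (b ^ k) y / real (b ^ k) ^ 3 \<in> E_set b \<phi>"
proof -
  define B where "B = b ^ k"
  note B' = q(2)[folded B_def]
  have B: "B \<ge> q + 2" using B' by simp
  note facts = redigit_nonneg[OF q(1) B] redigit_less_1[OF q(1) B] redigit_ge[OF q(1) B]
  define x where "x = redigit q B y / real B ^ 3"
  have B1: "real B \<ge> 3" using B q by linarith
  have B3: "real B ^ 3 > 1" using B1 by (intro one_less_power) auto
  have x0: "0 \<le> x" unfolding x_def using facts(1) by simp
  have x3: "x < 1 / real B ^ 3" unfolding x_def using facts(2) B1 by (intro divide_strict_right_mono) auto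
  have x1: "x < 1" using B3 by (intro order_less_trans[OF x3]) (auto simp: divide_less_eq_1)
  have lower: "1 / real B ^ 2 \<le> (T_map b ^^ n) x" if n: "n \<ge> 3 * k" for n
  proof -
    \<comment> \<open>\<open>k * M\<close> is the first multiple of k beyond n. At that time the
      orbit is a power of the base-B map, and \<open>M \<ge> 3\<close> ensures that the three
      prefixed zeros are gone.\<close>
    define M where "M = Suc (n div k)"
    define r where "r = k - n mod k"
    have nr: "n + r = k * M"
      unfolding M_def r_def mult_Suc_right
      using k mod_less_divisor[of k n] mult_div_mod_eq[of k n] by linarith
    have M: "M \<ge> 3" using n k by (simp add: M_def less_eq_div_iff_mult_less_eq le_SucI)
    have Tn: "(T_map b ^^ n) x = frac (real b ^ n * x)" using x0 x1 by (rule T_map_funpow)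
    have "frac (real b ^ r * frac (real b ^ n * x)) = frac (real b ^ (n + r) * x)"
      by (simp add: frac_of_nat_power_mult_frac power_add mult_ac)
    also have "real b ^ (n + r) * x = real B ^ M * x" by (simp add: nr power_mult B_def)
    also have "\<dots> = real B ^ (M - 3) * redigit q B y"
      using M B1 by (simp add: x_def power_diff)
    also have "frac \<dots> = redigit q B (frac (real q ^ (M - 3) * y))"
      by (rule frac_power_redigit[OF q(1) B])
    finally have "1 / real B \<le> frac (real b ^ r * frac (real b ^ n * x))" using facts(3) by simp
    also have "\<dots> \<le> real b ^ r * frac (real b ^ n * x)"
      using frac_ge_0 by (simp add: frac_def)
    \<comment> \<open>At most k further steps of the base-b map were added, so the bound
      \<open>1 / B\<close> at time \<open>n + r\<close> loses at most a factor B at time n.\<close>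
    also have "\<dots> \<le> real B * frac (real b ^ n * x)"
      using b frac_ge_0 by (auto simp: B_def r_def intro!: mult_right_mono power_increasing)
    finally show ?thesis unfolding Tn using B1 by (simp add: field_simps power2_eq_square)
  qed
  define c where "c = 1 / real B ^ 2 - 1 / real B ^ 3"
  have "c > 0" unfolding c_def using B1 by (simp add: field_simps power2_eq_square power3_eq_cube)
  then have "\<forall>\<^sub>F n in sequentially. \<phi> n < c" using \<phi> order_tendstoD(2) by blast
  moreover have "\<forall>\<^sub>F n in sequentially. n \<ge> 3 * k" by (rule eventually_ge_at_top)
  ultimately have "\<forall>\<^sub>F n in sequentially. \<bar>(T_map b ^^ n) x - x\<bar> \<ge> \<phi> n"
  proof eventually_elim
    case (elim n)
    show ?case using lower[OF elim(2)] elim(1) x3 by (simp add: c_def)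
  qed
  then show ?thesis using x0 x1 by (simp add: E_set_def x_def B_def)
qed

text \<open>For each \<open>k \<ge> 2\<close> the Cantor set in base \<open>b ^ k\<close> gives the
  lower bound \<open>log B (B - 2)\<close>, which tends to 1 with k.\<close>

lemma hausdorff_dim_E_set_eq_1:
  assumes b: "b \<ge> 2" and \<phi>: "\<phi> \<longlonglongrightarrow> 0"
  shows "hausdorff_dim (E_set b \<phi>) = 1"
proof (rule antisym)
  show "hausdorff_dim (E_set b \<phi>) \<le> 1" by (rule hausdorff_dim_unit_interval_le) (auto simp: E_set_def)
  have ge: "ennreal (log (real b ^ k) (real b ^ k - 2)) \<le> hausdorff_dim (E_set b \<phi>)" if k: "k \<ge> 2" for k
  proof -
    define B where "B = b ^ k"
    have "(4::nat) \<le> 2 ^ k" using power_increasing[of 2 k "2::nat"] k by simp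
    also have "\<dots> \<le> B" unfolding B_def using b by (intro power_mono) auto
    finally have "4 \<le> B" .
    define q where "q = B - 2"
    have q: "q \<ge> 1" "q \<ge> 2" "B = q + 2" using \<open>4 \<le> B\<close> by (auto simp: q_def)
    define s where "s = log (real B) (real q)"
    \<comment> \<open>The factor \<open>(B ^ 3) powr s\<close> undoes the contraction by
      \<open>B ^ 3\<close> coming from the three zeros; it changes the Hoelder constant but not the
      exponent.\<close>
    define C where "C = real q ^ 2 * (real B ^ 3) powr s"
    have "ennreal s \<le> hausdorff_dim (E_set b \<phi>)"
    proof (rule hausdorff_dim_ge_of_inverse_holder)
      show "0 < s" "0 < C" using q by (auto simp: s_def C_def)
      show "(\<lambda>y. redigit q B y / real B ^ 3) ` {0..<1} \<subseteq> E_set b \<phi>"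
        using redigit_in_E_set[of b k q \<phi>] b k q \<phi> by (auto simp: B_def)
      fix y z :: real assume yz: "y \<in> {0..<1}" "z \<in> {0..<1}"
      have "\<bar>y - z\<bar> \<le> real q ^ 2 * \<bar>redigit q B y - redigit q B z\<bar> powr s"
        unfolding s_def using q yz by (intro redigit_inverse_holder) auto
      also have "\<bar>redigit q B y - redigit q B z\<bar> =
          real B ^ 3 * \<bar>redigit q B y / real B ^ 3 - redigit q B z / real B ^ 3\<bar>"
        using q by (simp add: diff_divide_distrib[symmetric] abs_divide)
      finally show "\<bar>y - z\<bar> \<le> C * \<bar>redigit q B y / real B ^ 3 - redigit q B z / real B ^ 3\<bar> powr s"
        by (simp add: C_def powr_mult mult.assoc)
    qed
    moreover have "real b ^ k = real B" "real b ^ k - 2 = real q"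
      using q(3) by (simp_all add: B_def flip: of_nat_power)
    ultimately show ?thesis by (simp only: s_def)
  qed
  have "((\<lambda>x::real. log x (x - 2)) \<longlongrightarrow> 1) at_top" by real_asymp
  moreover have "filterlim (\<lambda>k. real b ^ k) at_top sequentially"
    using b by real_asymp
  ultimately have "(\<lambda>k. log (real b ^ k) (real b ^ k - 2)) \<longlonglongrightarrow> 1" by (rule filterlim_compose)
  then have "(\<lambda>k. ennreal (log (real b ^ k) (real b ^ k - 2))) \<longlonglongrightarrow> ennreal 1" by (rule tendsto_ennrealI)
  then show "1 \<le> hausdorff_dim (E_set b \<phi>)"
    using ge by (intro LIMSEQ_le_const2) auto
qed

theorem theorem1p11:
  fixes b :: nat and \<phi> :: "nat \<Rightarrow> real"
  assumes "b \<ge> 3" and "\<And>n. n \<ge> 1 \<Longrightarrow> \<phi> n > 0"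
  shows "(\<phi> \<longlonglongrightarrow> 0 \<longrightarrow> hausdorff_dim (E_set b \<phi>) = 1) \<and>
         (hausdorff_dim (E_set b \<phi>) = 1 \<longrightarrow> liminf (\<lambda>n. ereal (\<phi> n)) = 0)"
proof (intro conjI impI)
  show "hausdorff_dim (E_set b \<phi>) = 1" if "\<phi> \<longlonglongrightarrow> 0"
    using that assms(1) by (intro hausdorff_dim_E_set_eq_1) auto
  assume dim: "hausdorff_dim (E_set b \<phi>) = 1"
  show "liminf (\<lambda>n. ereal (\<phi> n)) = 0"
  proof (rule ccontr)
    assume "\<not> ?thesis"
    \<comment> \<open>Positivity of \<phi> makes the lower limit nonnegative, so being nonzero means
      being positive, and \<phi> is eventually bounded below by some \<epsilon> > 0.\<close>
    moreover have "\<forall>\<^sub>F n in sequentially. 0 \<le> ereal (\<phi> n)"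
      using eventually_ge_at_top[of 1] by eventually_elim (use assms(2) in \<open>auto intro: less_imp_le\<close>)
    then have "0 \<le> liminf (\<lambda>n. ereal (\<phi> n))" by (rule Liminf_bounded)
    ultimately have "0 < liminf (\<lambda>n. ereal (\<phi> n))" by auto
    then obtain \<epsilon> where \<epsilon>: "0 < ereal \<epsilon>" "ereal \<epsilon> < liminf (\<lambda>n. ereal (\<phi> n))"
      using ereal_dense2 by blast
    then have "\<forall>\<^sub>F n in sequentially. \<epsilon> \<le> \<phi> n"
      using less_LiminfD[OF \<epsilon>(2)] by (auto elim: eventually_mono)
    then have "hausdorff_dim (E_set b \<phi>) < 1"
      using assms(1) \<epsilon>(1) by (intro hausdorff_dim_E_set_less_1) auto
    then show False using dim by simp
  qed
qed

end
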